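(* Let $(A,\mu,\alpha)$ be a Hom-alternative algebra over $\mathbf{k}$, and let $g\colon A^{\otimes 5}\to A$ be the multilinear map $$\begin{aligned}g(u,v,w,x,y)&=f(uv,\alpha(w),\alpha(x),\alpha(y))-\alpha^3(u)f(v,w,x,y)-f(u,w,x,y)\alpha^3(v)\\&\quad-\alpha\big(as(u,x,y)\,\alpha([v,w])\big)-\alpha\big(\alpha([u,w])\,as(v,x,y)\big),\end{aligned}$$ where $f$ is the Hom-Bruck-Kleinfeld function of $A$. Then $g$ is alternating in $\{u,v,w\}$ and also in $\{x,y\}$; that is, $g$ changes sign when two of $u,v,w$ are interchanged, and when $x$ and $y$ are interchanged.
   Context: $\mathbf{k}$ is a fixed field of characteristic $0$; all modules, linear maps and tensor products are over $\mathbf{k}$. A Hom-algebra is a triple $(A,\mu,\alpha)$ with $A$ a $\mathbf{k}$-module, $\mu\colon A\otimes A\to A$ bilinear, written $\mu(a,b)=ab$ (not necessarily associative or unital), and $\alpha\colon A\to A$ linear with $\alpha(ab)=\alpha(a)\alpha(b)$ for all $a,b$. The Hom-associator is $as(x,y,z)=(xy)\alpha(z)-\alpha(x)(yz)$. $A$ is Hom-alternative if $as$ is alternating (changes by the sign of the permutation when its arguments are permuted). $[x,y]=xy-yx$ is the commutator bracket. The Hom-Bruck-Kleinfeld function $f\colon A^{\otimes4}\to A$ is $$f(w,x,y,z)=as(wx,\alpha(y),\alpha(z))-as(x,y,z)\alpha^2(w)-\alpha^2(x)as(w,y,z).$$ *)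

theory Defs
  imports Complex_Main "HOL-Combinatorics.Permutations"
begin

locale hom_algebra =
  fixes scale :: "'k::field_char_0 \<Rightarrow> 'a::ab_group_add \<Rightarrow> 'a"
    and \<mu> :: "'a \<Rightarrow> 'a \<Rightarrow> 'a"
    and \<alpha> :: "'a \<Rightarrow> 'a"
  assumes vector_space: "vector_space scale"
    and mult_linear_right: "\<And>a. Vector_Spaces.linear scale scale (\<lambda>b. \<mu> a b)"
    and mult_linear_left: "\<And>b. Vector_Spaces.linear scale scale (\<lambda>a. \<mu> a b)"
    and twist_linear: "Vector_Spaces.linear scale scale \<alpha>"
    and twist_mult: "\<And>a b. \<alpha> (\<mu> a b) = \<mu> (\<alpha> a) (\<alpha> b)"

definition commutator :: "('a \<Rightarrow> 'a \<Rightarrow> 'a) \<Rightarrow> 'a \<Rightarrow> 'a \<Rightarrow> 'a::ab_group_add" where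
  "commutator \<mu> x y = \<mu> x y - \<mu> y x"

definition hom_associator ::
  "('a \<Rightarrow> 'a \<Rightarrow> 'a) \<Rightarrow> ('a \<Rightarrow> 'a) \<Rightarrow> 'a \<Rightarrow> 'a \<Rightarrow> 'a \<Rightarrow> 'a::ab_group_add" where
  "hom_associator \<mu> \<alpha> x y z = \<mu> (\<mu> x y) (\<alpha> z) - \<mu> (\<alpha> x) (\<mu> y z)"

text \<open>
  The arguments of a function of \<open>n\<close> variables are gathered in a tuple \<open>t :: nat \<Rightarrow> 'a\<close>, of which
  only \<open>t 0, \<dots>, t (n - 1)\<close> matter. \<open>alternating_in S F\<close> says that permuting the arguments in
  the positions belonging to \<open>S\<close> multiplies the value of \<open>F\<close> by the sign of the permutation.
\<close>

definition alternating_in :: "nat set \<Rightarrow> ((nat \<Rightarrow> 'a) \<Rightarrow> 'b::ab_group_add) \<Rightarrow> bool" where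
  "alternating_in S F \<longleftrightarrow>
    (\<forall>p t. p permutes S \<longrightarrow> F (t \<circ> p) = (if evenperm p then F t else - F t))"

locale hom_alternative_algebra = hom_algebra +
  assumes associator_alternating:
    "alternating_in {0, 1, 2} (\<lambda>t. hom_associator \<mu> \<alpha> (t 0) (t 1) (t 2))"

definition hom_bruck_kleinfeld ::
  "('a \<Rightarrow> 'a \<Rightarrow> 'a) \<Rightarrow> ('a \<Rightarrow> 'a) \<Rightarrow> 'a \<Rightarrow> 'a \<Rightarrow> 'a \<Rightarrow> 'a \<Rightarrow> 'a::ab_group_add" where
  "hom_bruck_kleinfeld \<mu> \<alpha> w x y z =
     hom_associator \<mu> \<alpha> (\<mu> w x) (\<alpha> y) (\<alpha> z)
     - \<mu> (hom_associator \<mu> \<alpha> x y z) ((\<alpha> ^^ 2) w)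
     - \<mu> ((\<alpha> ^^ 2) x) (hom_associator \<mu> \<alpha> w y z)"

definition bruck_kleinfeld_g ::
  "('a \<Rightarrow> 'a \<Rightarrow> 'a) \<Rightarrow> ('a \<Rightarrow> 'a) \<Rightarrow> 'a \<Rightarrow> 'a \<Rightarrow> 'a \<Rightarrow> 'a \<Rightarrow> 'a \<Rightarrow> 'a::ab_group_add" where
  "bruck_kleinfeld_g \<mu> \<alpha> u v w x y =
     hom_bruck_kleinfeld \<mu> \<alpha> (\<mu> u v) (\<alpha> w) (\<alpha> x) (\<alpha> y)
     - \<mu> ((\<alpha> ^^ 3) u) (hom_bruck_kleinfeld \<mu> \<alpha> v w x y)
     - \<mu> (hom_bruck_kleinfeld \<mu> \<alpha> u w x y) ((\<alpha> ^^ 3) v)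
     - \<alpha> (\<mu> (hom_associator \<mu> \<alpha> u x y) (\<alpha> (commutator \<mu> v w)))
     - \<alpha> (\<mu> (\<alpha> (commutator \<mu> u w)) (hom_associator \<mu> \<alpha> v x y))"

context hom_algebra
begin

lemma bruck_kleinfeld_g_multilinear:
  "Vector_Spaces.linear scale scale (\<lambda>u. bruck_kleinfeld_g \<mu> \<alpha> u v w x y)"
  "Vector_Spaces.linear scale scale (\<lambda>v. bruck_kleinfeld_g \<mu> \<alpha> u v w x y)"
  "Vector_Spaces.linear scale scale (\<lambda>w. bruck_kleinfeld_g \<mu> \<alpha> u v w x y)"
  "Vector_Spaces.linear scale scale (\<lambda>x. bruck_kleinfeld_g \<mu> \<alpha> u v w x y)"
  "Vector_Spaces.linear scale scale (\<lambda>y. bruck_kleinfeld_g \<mu> \<alpha> u v w x y)"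
proof -
  interpret vector_space scale by (rule vector_space)
  interpret vs: vector_space_pair scale scale by unfold_locales
  have add: "\<mu> a (b + c) = \<mu> a b + \<mu> a c" "\<mu> (b + c) a = \<mu> b a + \<mu> c a"
      "\<alpha> (b + c) = \<alpha> b + \<alpha> c" "\<mu> a (b - c) = \<mu> a b - \<mu> a c"
      "\<mu> (b - c) a = \<mu> b a - \<mu> c a" "\<alpha> (b - c) = \<alpha> b - \<alpha> c" for a b c
    using vs.linear_add[OF mult_linear_right] vs.linear_add[OF mult_linear_left]
      vs.linear_add[OF twist_linear] vs.linear_diff[OF mult_linear_right]
      vs.linear_diff[OF mult_linear_left] vs.linear_diff[OF twist_linear]
    by blast+
  have scl: "\<mu> a (scale r b) = scale r (\<mu> a b)" "\<mu> (scale r b) a = scale r (\<mu> b a)"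
      "\<alpha> (scale r b) = scale r (\<alpha> b)" for a b r
    using vs.linear_scale[OF mult_linear_right] vs.linear_scale[OF mult_linear_left]
      vs.linear_scale[OF twist_linear]
    by blast+
  note defs = bruck_kleinfeld_g_def hom_bruck_kleinfeld_def hom_associator_def
    commutator_def numeral_eq_Suc
  show "Vector_Spaces.linear scale scale (\<lambda>u. bruck_kleinfeld_g \<mu> \<alpha> u v w x y)"
    "Vector_Spaces.linear scale scale (\<lambda>v. bruck_kleinfeld_g \<mu> \<alpha> u v w x y)"
    "Vector_Spaces.linear scale scale (\<lambda>w. bruck_kleinfeld_g \<mu> \<alpha> u v w x y)"
    "Vector_Spaces.linear scale scale (\<lambda>x. bruck_kleinfeld_g \<mu> \<alpha> u v w x y)"
    "Vector_Spaces.linear scale scale (\<lambda>y. bruck_kleinfeld_g \<mu> \<alpha> u v w x y)"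
    by (unfold_locales; simp add: defs add scl scale_right_diff_distrib scale_right_distrib)+
qed

end

end

theory Submission
  imports Defs
begin

text \<open>
  The proof has two stages, and both follow the same pattern: a relation between cyclic shifts of a
  function is shown to have a right-hand side with known symmetry, and this forces the symmetry of
  the function.

  \<^item> \<^emph>\<open>The function \<open>f\<close> is alternating.\<close> The Teichmueller identity, which holds in every
    Hom-algebra, relates the associators \<open>as(wx,y,z)\<close>, \<open>as(w,xy,z)\<close> and \<open>as(w,x,yz)\<close> (twists omitted).
    When the associator alternates, it expresses \<open>f(w,x,y,z) - f(x,y,z,w) + f(y,z,w,x)\<close> as a sum of
    commutators that changes sign under the cyclic shift of \<open>w,x,y,z\<close>. Adding the relation to its
    own shift telescopes to \<open>f(w,x,y,z) + f(z,w,x,y) = 0\<close> (\<open>bruck_kleinfeld_cyclic\<close>). The shift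
    and the interchange of \<open>y,z\<close>, under which \<open>f\<close> changes sign by its definition, generate all
    permutations.

  \<^item> \<^emph>\<open>The function \<open>g\<close> is alternating in \<open>u,v,w\<close>.\<close> Fix \<open>x,y\<close> and let \<open>D(a) = as(a,x,y)\<close>. The
    definition of \<open>f\<close> says that \<open>f\<close> measures how far \<open>D\<close> is from an anti-derivation:
    \<open>D(ab) = D(b)a + bD(a) + f(a,b,x,y)\<close>. Applying this twice to both terms of
    \<open>D(as(u,v,w)) = D((uv)w) - D(u(vw))\<close> gives
    \<open>g(u,v,w) + g(v,w,u) = S(u,v,w)\<close>, where \<open>S\<close> is built from \<open>D\<close>, associators and commutators and
    visibly alternates in \<open>u,v,w\<close> once \<open>as\<close> and \<open>f\<close> do (\<open>bruck_kleinfeld_g_cyclic_sum\<close>). As \<open>S\<close>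
    is invariant under the cyclic shift, so is \<open>g\<close>; hence \<open>2g = S\<close>, and \<open>g\<close> alternates because \<open>2\<close> is invertible.
\<close>

section \<open>Alternating functions and transpositions\<close>

lemma alternating_in_transpose:
  assumes "alternating_in S F" "a \<in> S" "b \<in> S" "a \<noteq> b"
  shows "F (t \<circ> transpose a b) = - F t"
  using assms permutes_swap_id[of a S b] evenperm_swap[of a b]
  unfolding alternating_in_def by simp

lemma alternating_inI:
  assumes "finite S"
    and "\<And>a b t. a \<in> S \<Longrightarrow> b \<in> S \<Longrightarrow> a \<noteq> b \<Longrightarrow> F (t \<circ> transpose a b) = - F t"
  shows "alternating_in S F"
proof -
  have "F (t \<circ> p) = (if evenperm p then F t else - F t)" if "p permutes S" for p t
    using that \<open>finite S\<close>
  proof (induction arbitrary: t rule: permutes_induct)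
    case id
    then show ?case by simp
  next
    case (swap a b p)
    have "evenperm (transpose a b \<circ> p) \<longleftrightarrow> \<not> evenperm p"
      using swap \<open>finite S\<close>
      by (simp add: evenperm_comp permutation_swap_id evenperm_swap permutes_imp_permutation)
    moreover have "F (t \<circ> (transpose a b \<circ> p)) = F ((t \<circ> transpose a b) \<circ> p)"
      by (simp add: comp_assoc)
    ultimately show ?case
      using swap assms(2)[of a b t] by (metis add.inverse_inverse)
  qed
  then show ?thesis
    unfolding alternating_in_def by blast
qed

section \<open>Hom-algebras\<close>

context hom_algebra
begin

abbreviation assoc where "assoc \<equiv> hom_associator \<mu> \<alpha>"
abbreviation f where "f \<equiv> hom_bruck_kleinfeld \<mu> \<alpha>"
abbreviation g where "g \<equiv> bruck_kleinfeld_g \<mu> \<alpha>"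
abbreviation comm where "comm \<equiv> commutator \<mu>"

lemma additive:
  "\<mu> a (b + c) = \<mu> a b + \<mu> a c" "\<mu> (b + c) a = \<mu> b a + \<mu> c a"
  "\<mu> a (b - c) = \<mu> a b - \<mu> a c" "\<mu> (b - c) a = \<mu> b a - \<mu> c a"
  "\<mu> a (- b) = - \<mu> a b" "\<mu> (- b) a = - \<mu> b a"
  "\<alpha> (b + c) = \<alpha> b + \<alpha> c" "\<alpha> (b - c) = \<alpha> b - \<alpha> c" "\<alpha> (- b) = - \<alpha> b"
proof -
  interpret vector_space scale by (rule vector_space)
  interpret vs: vector_space_pair scale scale by unfold_locales
  show "\<mu> a (b + c) = \<mu> a b + \<mu> a c" "\<mu> a (b - c) = \<mu> a b - \<mu> a c"
      "\<mu> a (- b) = - \<mu> a b"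
    by (fact vs.linear_add[OF mult_linear_right] vs.linear_diff[OF mult_linear_right]
        vs.linear_neg[OF mult_linear_right])+
  show "\<mu> (b + c) a = \<mu> b a + \<mu> c a" "\<mu> (b - c) a = \<mu> b a - \<mu> c a"
      "\<mu> (- b) a = - \<mu> b a"
    by (fact vs.linear_add[OF mult_linear_left] vs.linear_diff[OF mult_linear_left]
        vs.linear_neg[OF mult_linear_left])+
  show "\<alpha> (b + c) = \<alpha> b + \<alpha> c" "\<alpha> (b - c) = \<alpha> b - \<alpha> c" "\<alpha> (- b) = - \<alpha> b"
    by (fact vs.linear_add[OF twist_linear] vs.linear_diff[OF twist_linear]
        vs.linear_neg[OF twist_linear])+
qed

lemma twist_associator: "\<alpha> (assoc a b c) = assoc (\<alpha> a) (\<alpha> b) (\<alpha> c)"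
  by (simp add: hom_associator_def additive twist_mult)

lemma associator_minus:
  "assoc (- a) b c = - assoc a b c"
  by (simp add: hom_associator_def additive)

lemma double_eq_0:
  fixes a :: 'a
  assumes "a + a = 0"
  shows "a = 0"
proof -
  interpret vector_space scale by (rule vector_space)
  have "scale 2 a = a + a"
    using scale_left_distrib[of 1 1 a] by simp
  then show ?thesis
    using assms by simp
qed

lemma teichmuller:
  "assoc (\<mu> w x) (\<alpha> y) (\<alpha> z) - assoc (\<alpha> w) (\<mu> x y) (\<alpha> z) + assoc (\<alpha> w) (\<alpha> x) (\<mu> y z)
    = \<mu> (\<alpha> (\<alpha> w)) (assoc x y z) + \<mu> (assoc w x y) (\<alpha> (\<alpha> z))"
  by (simp add: hom_associator_def additive twist_mult)

text \<open>The defining equation of \<open>f\<close>, read as the failure of \<open>a \<mapsto> as(a,x,y)\<close> to be an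
  anti-derivation.\<close>
lemma associator_mult:
  "assoc (\<mu> u v) (\<alpha> x) (\<alpha> y)
    = \<mu> (assoc v x y) (\<alpha> (\<alpha> u)) + \<mu> (\<alpha> (\<alpha> v)) (assoc u x y) + f u v x y"
  by (simp add: hom_bruck_kleinfeld_def numeral_eq_Suc)

end

section \<open>The Bruck-Kleinfeld function of a Hom-alternative algebra\<close>

context hom_alternative_algebra
begin

lemma associator_swap:
  "assoc b a c = - assoc a b c" "assoc a c b = - assoc a b c"
proof -
  define t where "t = (\<lambda>i :: nat. if i = 0 then a else if i = 1 then b else c)"
  show "assoc b a c = - assoc a b c" "assoc a c b = - assoc a b c"
    using alternating_in_transpose[OF associator_alternating, of 0 1 t]
      alternating_in_transpose[OF associator_alternating, of 1 2 t]
    by (simp_all add: t_def)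
qed

lemma associator_rotate: "assoc b c a = assoc a b c"
  using associator_swap(1)[of a b c] associator_swap(2)[of b a c] by simp

lemma bruck_kleinfeld_swap_last: "f u v y x = - f u v x y"
  by (simp add: hom_bruck_kleinfeld_def associator_swap(2)[of _ x y]
      associator_swap(2)[of _ "\<alpha> x" "\<alpha> y"] additive)

text \<open>The Teichmueller identity with every associator rotated so that the product comes first, and
  then rewritten by the definition of \<open>f\<close>. The right-hand side changes sign when \<open>w,x,y,z\<close> are
  shifted cyclically.\<close>
lemma bruck_kleinfeld_teichmuller:
  "f w x y z - f x y z w + f y z w x
    = comm (\<alpha> (\<alpha> w)) (assoc x y z) - comm (\<alpha> (\<alpha> x)) (assoc y z w)
      + comm (\<alpha> (\<alpha> y)) (assoc z w x) - comm (\<alpha> (\<alpha> z)) (assoc w x y)"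
  using teichmuller[of w x y z]
  by (simp add: associator_rotate[of "\<mu> x y" "\<alpha> z" "\<alpha> w", symmetric]
      associator_rotate[of "\<alpha> w" "\<alpha> x" "\<mu> y z"] associator_mult
      associator_rotate[of y z w] associator_rotate[of z w x] associator_rotate[of w x y]
      commutator_def algebra_simps)

lemma bruck_kleinfeld_cyclic: "f z w x y = - f w x y z"
proof -
  have "f z w x y + f w x y z
      = (f w x y z - f x y z w + f y z w x) + (f x y z w - f y z w x + f z w x y)"
    by simp
  also have "\<dots> = 0"
    by (simp add: bruck_kleinfeld_teichmuller)
  finally show ?thesis
    by (simp only: eq_neg_iff_add_eq_0)
qed

lemma bruck_kleinfeld_swap_first: "f v u x y = - f u v x y"
proof -
  \<comment> \<open>Two cyclic shifts exchange the first pair of arguments with the last pair.\<close>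
  have shift2: "f a b c d = f c d a b" for a b c d
    using bruck_kleinfeld_cyclic[of a b c d] bruck_kleinfeld_cyclic[of b c d a] by simp
  have "f v u x y = f x y v u"
    by (rule shift2)
  also have "\<dots> = - f x y u v"
    by (rule bruck_kleinfeld_swap_last)
  also have "f x y u v = f u v x y"
    by (rule shift2)
  finally show ?thesis .
qed

section \<open>The derived function of five arguments\<close>

text \<open>This is the function called \<open>S\<close> above. Each of the three bracketed sums runs over the cyclic
  rotations of a term that changes sign when one particular pair of \<open>u,v,w\<close> is interchanged (in the
  first summand, \<open>v\<close> and \<open>w\<close>), which makes the sum alternating in all three.\<close>
definition g_cyclic_sum where
  "g_cyclic_sum x y u v w =
     assoc (assoc u v w) (\<alpha> (\<alpha> x)) (\<alpha> (\<alpha> y))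
     - (assoc (assoc u x y) (\<alpha> (\<alpha> v)) (\<alpha> (\<alpha> w))
        + assoc (assoc v x y) (\<alpha> (\<alpha> w)) (\<alpha> (\<alpha> u))
        + assoc (assoc w x y) (\<alpha> (\<alpha> u)) (\<alpha> (\<alpha> v)))
     - (comm (\<alpha> (\<alpha> (\<alpha> u))) (f v w x y) + comm (\<alpha> (\<alpha> (\<alpha> v))) (f w u x y)
        + comm (\<alpha> (\<alpha> (\<alpha> w))) (f u v x y))
     - (comm (\<alpha> (assoc u x y)) (\<alpha> (\<alpha> (comm v w)))
        + comm (\<alpha> (assoc v x y)) (\<alpha> (\<alpha> (comm w u)))
        + comm (\<alpha> (assoc w x y)) (\<alpha> (\<alpha> (comm u v))))"

lemma g_cyclic_sum_rotate: "g_cyclic_sum x y v w u = g_cyclic_sum x y u v w"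
  by (simp add: g_cyclic_sum_def associator_rotate[of v w u] algebra_simps)

lemma g_cyclic_sum_swap: "g_cyclic_sum x y v u w = - g_cyclic_sum x y u v w"
proof -
  have comm_swap: "comm b a = - comm a b" for a b
    by (simp add: commutator_def)
  have comm_minus: "comm a (- b) = - comm a b" for a b
    by (simp add: commutator_def additive)
  show ?thesis
    unfolding g_cyclic_sum_def
    by (simp add: associator_swap(1)[of v u] associator_swap(2)[of _ "\<alpha> (\<alpha> u)" "\<alpha> (\<alpha> v)"]
        associator_swap(2)[of _ "\<alpha> (\<alpha> v)" "\<alpha> (\<alpha> w)"] associator_swap(2)[of _ "\<alpha> (\<alpha> w)" "\<alpha> (\<alpha> u)"]
        associator_minus bruck_kleinfeld_swap_first[of v u] bruck_kleinfeld_swap_first[of w v]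
        bruck_kleinfeld_swap_first[of u w] comm_swap[of v u] comm_swap[of w v] comm_swap[of u w]
        comm_minus additive algebra_simps)
qed

text \<open>The inner associator of \<open>as(as(u,v,w),x,y)\<close> is \<open>(uv)w - u(vw)\<close>. Expanding both terms by
  \<open>associator_mult\<close> produces \<open>f(uv,w,x,y)\<close> and \<open>f(vw,u,x,y)\<close>, the leading terms of the two values
  of \<open>g\<close>. The remaining differences of triple products are associators up to a product with a
  commutator, and these products combine with those in the definition of \<open>g\<close> into commutators.\<close>
lemma bruck_kleinfeld_g_cyclic_sum:
  "g u v w x y + g v w u x y = g_cyclic_sum x y u v w"
proof -
  let ?x = "\<alpha> (\<alpha> x)" and ?y = "\<alpha> (\<alpha> y)"
  have left: "assoc (\<mu> (\<mu> u v) (\<alpha> w)) ?x ?y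
      = \<mu> (\<alpha> (assoc w x y)) (\<alpha> (\<alpha> (\<mu> u v)))
        + \<mu> (\<alpha> (\<alpha> (\<alpha> w)))
            (\<mu> (assoc v x y) (\<alpha> (\<alpha> u)) + \<mu> (\<alpha> (\<alpha> v)) (assoc u x y) + f u v x y)
        + f (\<mu> u v) (\<alpha> w) (\<alpha> x) (\<alpha> y)"
    by (simp add: associator_mult twist_associator)
  have right: "assoc (\<mu> (\<alpha> u) (\<mu> v w)) ?x ?y
      = \<mu> (\<mu> (assoc w x y) (\<alpha> (\<alpha> v)) + \<mu> (\<alpha> (\<alpha> w)) (assoc v x y) + f v w x y)
            (\<alpha> (\<alpha> (\<alpha> u)))
        + \<mu> (\<alpha> (\<alpha> (\<mu> v w))) (\<alpha> (assoc u x y))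
        - f (\<mu> v w) (\<alpha> u) (\<alpha> x) (\<alpha> y)"
    by (simp add: associator_mult twist_associator bruck_kleinfeld_swap_first[of "\<alpha> u" "\<mu> v w"])
  have split: "assoc (assoc u v w) ?x ?y
      = assoc (\<mu> (\<mu> u v) (\<alpha> w)) ?x ?y - assoc (\<mu> (\<alpha> u) (\<mu> v w)) ?x ?y"
    by (simp add: hom_associator_def additive)
  \<comment> \<open>The arguments are put in the order in which the two expansions associate them.\<close>
  have outer:
    "assoc (assoc u x y) (\<alpha> (\<alpha> v)) (\<alpha> (\<alpha> w)) = - assoc (\<alpha> (\<alpha> w)) (\<alpha> (\<alpha> v)) (assoc u x y)"
    "assoc (assoc v x y) (\<alpha> (\<alpha> w)) (\<alpha> (\<alpha> u)) = - assoc (\<alpha> (\<alpha> w)) (assoc v x y) (\<alpha> (\<alpha> u))"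
    "assoc (assoc w x y) (\<alpha> (\<alpha> u)) (\<alpha> (\<alpha> v)) = - assoc (assoc w x y) (\<alpha> (\<alpha> v)) (\<alpha> (\<alpha> u))"
    using associator_rotate[of "\<alpha> (\<alpha> w)" "\<alpha> (\<alpha> v)" "assoc u x y"]
      associator_swap(2)[of "assoc u x y" "\<alpha> (\<alpha> v)" "\<alpha> (\<alpha> w)"]
      associator_swap(1)[of "assoc v x y" "\<alpha> (\<alpha> w)" "\<alpha> (\<alpha> u)"]
      associator_swap(2)[of "assoc w x y" "\<alpha> (\<alpha> u)" "\<alpha> (\<alpha> v)"]
    by simp_all
  have expand: "assoc (\<alpha> (\<alpha> w)) (\<alpha> (\<alpha> v)) (assoc u x y)
      = \<mu> (\<mu> (\<alpha> (\<alpha> w)) (\<alpha> (\<alpha> v))) (\<alpha> (assoc u x y))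
        - \<mu> (\<alpha> (\<alpha> (\<alpha> w))) (\<mu> (\<alpha> (\<alpha> v)) (assoc u x y))"
    "assoc (\<alpha> (\<alpha> w)) (assoc v x y) (\<alpha> (\<alpha> u))
      = \<mu> (\<mu> (\<alpha> (\<alpha> w)) (assoc v x y)) (\<alpha> (\<alpha> (\<alpha> u)))
        - \<mu> (\<alpha> (\<alpha> (\<alpha> w))) (\<mu> (assoc v x y) (\<alpha> (\<alpha> u)))"
    "assoc (assoc w x y) (\<alpha> (\<alpha> v)) (\<alpha> (\<alpha> u))
      = \<mu> (\<mu> (assoc w x y) (\<alpha> (\<alpha> v))) (\<alpha> (\<alpha> (\<alpha> u)))
        - \<mu> (\<alpha> (assoc w x y)) (\<mu> (\<alpha> (\<alpha> v)) (\<alpha> (\<alpha> u)))"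
    by (simp_all add: hom_associator_def[of \<mu> \<alpha> "\<alpha> (\<alpha> w)"]
        hom_associator_def[of \<mu> \<alpha> "assoc w x y"])
  show ?thesis
    unfolding g_cyclic_sum_def split left right outer expand
    by (simp add: bruck_kleinfeld_g_def numeral_eq_Suc commutator_def additive twist_mult
        bruck_kleinfeld_swap_first[of w u] bruck_kleinfeld_swap_first[of v u] algebra_simps)
qed

lemma bruck_kleinfeld_g_rotate: "g v w u x y = g u v w x y"
  using bruck_kleinfeld_g_cyclic_sum[of v w u x y] bruck_kleinfeld_g_cyclic_sum[of w u v x y]
    g_cyclic_sum_rotate[of x y w u v]
  by (metis add.commute add_left_cancel)

lemma bruck_kleinfeld_g_swap12: "g v u w x y = - g u v w x y"
proof -
  have double: "g a b c x y + g a b c x y = g_cyclic_sum x y a b c" for a b c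
    using bruck_kleinfeld_g_cyclic_sum[of a b c x y] by (simp add: bruck_kleinfeld_g_rotate)
  have "(g u v w x y + g v u w x y) + (g u v w x y + g v u w x y)
      = g_cyclic_sum x y u v w + g_cyclic_sum x y v u w"
    by (simp add: double[symmetric] algebra_simps)
  also have "\<dots> = 0"
    by (simp add: g_cyclic_sum_swap[of x y u v w])
  finally show ?thesis
    using double_eq_0 by (metis add.inverse_unique)
qed

lemma bruck_kleinfeld_g_swap23: "g u w v x y = - g u v w x y"
  using bruck_kleinfeld_g_swap12[of w v u x y] bruck_kleinfeld_g_rotate[of w v u x y]
    bruck_kleinfeld_g_rotate[of v w u x y]
  by simp

lemma bruck_kleinfeld_g_swap13: "g w v u x y = - g u v w x y"
  using bruck_kleinfeld_g_swap12[of w v u x y] bruck_kleinfeld_g_rotate[of v w u x y]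
  by simp

lemma bruck_kleinfeld_g_swap_last: "g u v w y x = - g u v w x y"
  by (simp add: bruck_kleinfeld_g_def bruck_kleinfeld_swap_last[of _ _ x y]
      bruck_kleinfeld_swap_last[of _ _ "\<alpha> x" "\<alpha> y"] associator_swap(2)[of _ x y]
      additive algebra_simps)

end

theorem proposition6p5:
  fixes scale :: "'k::field_char_0 \<Rightarrow> 'a::ab_group_add \<Rightarrow> 'a"
    and \<mu> :: "'a \<Rightarrow> 'a \<Rightarrow> 'a"
    and \<alpha> :: "'a \<Rightarrow> 'a"
    and g :: "'a \<Rightarrow> 'a \<Rightarrow> 'a \<Rightarrow> 'a \<Rightarrow> 'a \<Rightarrow> 'a"
  assumes A: "hom_alternative_algebra scale \<mu> \<alpha>"
    and g: "g = bruck_kleinfeld_g \<mu> \<alpha>"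
  shows "alternating_in {0, 1, 2} (\<lambda>t. g (t 0) (t 1) (t 2) (t 3) (t 4))
    \<and> alternating_in {3, 4} (\<lambda>t. g (t 0) (t 1) (t 2) (t 3) (t 4))
    \<and> (\<forall>u v w x y.
          g v u w x y = - g u v w x y \<and>
          g w v u x y = - g u v w x y \<and>
          g u w v x y = - g u v w x y \<and>
          g u v w y x = - g u v w x y)"
proof -
  interpret hom_alternative_algebra scale \<mu> \<alpha> by (rule A)
  note swaps = bruck_kleinfeld_g_swap12 bruck_kleinfeld_g_swap13 bruck_kleinfeld_g_swap23
    bruck_kleinfeld_g_swap_last
  have "alternating_in {0, 1, 2} (\<lambda>t. g (t 0) (t 1) (t 2) (t 3) (t 4))"
  proof (rule alternating_inI)
    fix a b :: nat and t :: "nat \<Rightarrow> 'a"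
    assume ab: "a \<in> {0, 1, 2}" "b \<in> {0, 1, 2}" "a \<noteq> b"
    show "g ((t \<circ> transpose a b) 0) ((t \<circ> transpose a b) 1) ((t \<circ> transpose a b) 2)
        ((t \<circ> transpose a b) 3) ((t \<circ> transpose a b) 4) = - g (t 0) (t 1) (t 2) (t 3) (t 4)"
      using ab swaps(1)[of "t 1" "t 0"] swaps(2)[of "t 2" "t 1" "t 0"]
        swaps(3)[of "t 0" "t 2" "t 1"]
      unfolding g by (auto simp: transpose_def)
  qed simp
  moreover have "alternating_in {3, 4} (\<lambda>t. g (t 0) (t 1) (t 2) (t 3) (t 4))"
  proof (rule alternating_inI)
    fix a b :: nat and t :: "nat \<Rightarrow> 'a"
    assume ab: "a \<in> {3, 4}" "b \<in> {3, 4}" "a \<noteq> b"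
    show "g ((t \<circ> transpose a b) 0) ((t \<circ> transpose a b) 1) ((t \<circ> transpose a b) 2)
        ((t \<circ> transpose a b) 3) ((t \<circ> transpose a b) 4) = - g (t 0) (t 1) (t 2) (t 3) (t 4)"
      using ab swaps(4)[of "t 0" "t 1" "t 2" "t 4" "t 3"]
      unfolding g by (auto simp: transpose_def)
  qed simp
  ultimately show ?thesis
    unfolding g by (intro conjI allI swaps)
qed

end
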